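(* Let $\mathcal X$ be a reflexive real Banach space, let $f\in\Gamma_0(\mathcal X)$ be a Legendre function, let $\alpha\in\left]0,+\infty\right[$, let $(f_n)_{n\in\mathbb N}$ be in $\mathcal P_\alpha(f)$, let $(x_n)_{n\in\mathbb N}$ be a sequence in $\operatorname{int}\operatorname{dom}f$, and let $C$ be a closed convex subset of $\mathcal X$ such that $C\cap\operatorname{int}\operatorname{dom}f\neq\varnothing$. Suppose that $(x_n)_{n\in\mathbb N}$ is stationarily quasi-Bregman monotone with respect to $C$ relative to $(f_n)_{n\in\mathbb N}$, that for all bounded sequences $(u_n)_{n\in\mathbb N}$ and $(v_n)_{n\in\mathbb N}$ in $\operatorname{int}\operatorname{dom}f$, $D^f(u_n,v_n)\to0$ implies $u_n-v_n\to0$, and that, for every $x\in\operatorname{int}\operatorname{dom}f$, $D^f(x,\cdot)$ is coercive. In addition, suppose that there exists $\beta\in\left]0,+\infty\right[$ such that $\beta\hat f\succcurlyeq f_n$ for every $n\in\mathbb N$. Then $(x_n)_{n\in\mathbb N}$ converges strongly to a point in $C\cap\overline{\operatorname{dom}f}$ if and only if $\varliminf D^f_C(x_n)=0$.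
   Context: $\langle\cdot,\cdot\rangle$ is the duality pairing between $\mathcal X$ and its dual $\mathcal X^*$, $\|\cdot\|$ the norm. $\Gamma_0(\mathcal X)$ is the class of lower semicontinuous convex functions $f\colon\mathcal X\to\left]-\infty,+\infty\right]$ with $\operatorname{dom}f=\{x\mid f(x)<+\infty\}\neq\varnothing$; $f^*$ is the conjugate and $\partial f$ the convex subdifferential. $\ell^1_+(\mathbb N)$ is the set of summable sequences in $\left[0,+\infty\right[$. A function $h$ is coercive if $h(x)\to+\infty$ as $\|x\|\to+\infty$. An overline denotes norm closure. Bregman distance: for a convex function $f$ that is Gâteaux differentiable on $\operatorname{int}\operatorname{dom}f\neq\varnothing$, $D^f\colon\mathcal X\times\mathcal X\to[0,+\infty]$ is $D^f(x,y)=f(x)-f(y)-\langle x-y,\nabla f(y)\rangle$ if $y\in\operatorname{int}\operatorname{dom}f$, and $D^f(x,y)=+\infty$ otherwise. For $C\subset\mathcal X$, $D^f_C(y)=\inf_{x\in C}D^f(x,y)$. Legendre: $f\in\Gamma_0(\mathcal X)$ is a Legendre function if $\partial f$ is both locally bounded and single-valued on its domain, and $\partial f^*$ is locally bounded on its domain and $f$ is strictly convex on every convex subset of $\operatorname{dom}\partial f$. (A Legendre function is Gâteaux differentiable on $\operatorname{int}\operatorname{dom}f=\operatorname{dom}\partial f\ne\varnothing$.) $\mathcal F(f)=\{g\in\Gamma_0(\mathcal X)\mid g\text{ is Gâteaux differentiable on }\operatorname{dom}g=\operatorname{int}\operatorname{dom}f\}$. $\hat f$ is the function equal to $f$ on $\operatorname{int}\operatorname{dom}f$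 and $+\infty$ elsewhere. The relation $g_1\succcurlyeq g_2$ means $D^{g_1}(x,y)\geq D^{g_2}(x,y)$ for all $x\in\operatorname{dom}f$ and all $y\in\operatorname{int}\operatorname{dom}f$ (used for elements of $\mathcal F(f)$ and positive multiples of $f$ and $\hat f$). $\mathcal P_\alpha(f)=\{g\in\mathcal F(f)\mid g\succcurlyeq\alpha f\}$. Let $(f_n)_{n\in\mathbb N}$ be in $\mathcal F(f)$, $(x_n)_{n\in\mathbb N}$ in $\operatorname{int}\operatorname{dom}f$, and $C\subset\mathcal X$ with $C\cap\operatorname{dom}f\neq\varnothing$. $(x_n)$ is stationarily quasi-Bregman monotone with respect to $C$ relative to $(f_n)$ if there exist $(\varepsilon_n)_{n\in\mathbb N}$ and $(\eta_n)_{n\in\mathbb N}$ in $\ell^1_+(\mathbb N)$ such that for all $x\in C\cap\operatorname{dom}f$ and all $n\in\mathbb N$, $D^{f_{n+1}}(x,x_{n+1})\leq(1+\eta_n)D^{f_n}(x,x_n)+\varepsilon_n$. *)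

theory Defs
  imports "HOL-Analysis.Analysis"
begin

text \<open>The dual of a normed space \<open>'a\<close> is the space \<open>'a \<Rightarrow>\<^sub>L real\<close> of bounded linear functionals, and the
  bidual is obtained by iterating this construction.\<close>

definition reflexive_space :: "'a::real_normed_vector itself \<Rightarrow> bool" where
  "reflexive_space _ \<longleftrightarrow>
     (\<forall>\<phi> :: ('a \<Rightarrow>\<^sub>L real) \<Rightarrow>\<^sub>L real. \<exists>x :: 'a. \<forall>l. blinfun_apply \<phi> l = blinfun_apply l x)"

definition edom :: "('a \<Rightarrow> ereal) \<Rightarrow> 'a set" where
  "edom f = {x. f x < \<infinity>}"

definition lsc :: "('a::topological_space \<Rightarrow> ereal) \<Rightarrow> bool" where
  "lsc f \<longleftrightarrow> (\<forall>x. f x \<le> Liminf (nhds x) f)"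

definition convex_fun :: "('a::real_vector \<Rightarrow> ereal) \<Rightarrow> bool" where
  "convex_fun f \<longleftrightarrow>
     (\<forall>x y t. 0 < t \<longrightarrow> t < 1 \<longrightarrow>
        f ((1 - t) *\<^sub>R x + t *\<^sub>R y) \<le> ereal (1 - t) * f x + ereal t * f y)"

definition strictly_convex_fun_on :: "'a::real_vector set \<Rightarrow> ('a \<Rightarrow> ereal) \<Rightarrow> bool" where
  "strictly_convex_fun_on S f \<longleftrightarrow>
     (\<forall>x\<in>S. \<forall>y\<in>S. \<forall>t. x \<noteq> y \<longrightarrow> 0 < t \<longrightarrow> t < 1 \<longrightarrow>
        f ((1 - t) *\<^sub>R x + t *\<^sub>R y) < ereal (1 - t) * f x + ereal t * f y)"

definition Gamma0 :: "('a::real_normed_vector \<Rightarrow> ereal) set" where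
  "Gamma0 = {f. lsc f \<and> convex_fun f \<and> (\<forall>x. f x \<noteq> -\<infinity>) \<and> edom f \<noteq> {}}"

definition conjugate :: "('a::real_normed_vector \<Rightarrow> ereal) \<Rightarrow> ('a \<Rightarrow>\<^sub>L real) \<Rightarrow> ereal" where
  "conjugate f l = (SUP x. ereal (blinfun_apply l x) - f x)"

definition subdifferential ::
  "('a::real_normed_vector \<Rightarrow> ereal) \<Rightarrow> 'a \<Rightarrow> ('a \<Rightarrow>\<^sub>L real) set" where
  "subdifferential f x = {l. \<forall>y. ereal (blinfun_apply l (y - x)) + f x \<le> f y}"

definition op_dom :: "('a \<Rightarrow> 'b set) \<Rightarrow> 'a set" where
  "op_dom A = {x. A x \<noteq> {}}"

definition locally_bounded_on_dom ::
  "('a::topological_space \<Rightarrow> 'b::metric_space set) \<Rightarrow> bool" where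
  "locally_bounded_on_dom A \<longleftrightarrow>
     (\<forall>x\<in>op_dom A. \<exists>U. open U \<and> x \<in> U \<and> bounded (\<Union>y\<in>U. A y))"

definition single_valued_on_dom :: "('a \<Rightarrow> 'b set) \<Rightarrow> bool" where
  "single_valued_on_dom A \<longleftrightarrow> (\<forall>x\<in>op_dom A. \<exists>l. A x = {l})"

text \<open>The subdifferential of the conjugate takes its values in the bidual; in a reflexive space these
  are identified, isometrically, with subsets of \<open>'a\<close>, so boundedness has the same meaning.\<close>

definition Legendre :: "('a::real_normed_vector \<Rightarrow> ereal) \<Rightarrow> bool" where
  "Legendre f \<longleftrightarrow> f \<in> Gamma0 \<and>
     locally_bounded_on_dom (subdifferential f) \<and>
     single_valued_on_dom (subdifferential f) \<and>
     locally_bounded_on_dom (subdifferential (conjugate f)) \<and>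
     (\<forall>S. convex S \<longrightarrow> S \<subseteq> op_dom (subdifferential f) \<longrightarrow> strictly_convex_fun_on S f)"

definition has_gateaux_gradient ::
  "('a::real_normed_vector \<Rightarrow> ereal) \<Rightarrow> ('a \<Rightarrow>\<^sub>L real) \<Rightarrow> 'a \<Rightarrow> bool" where
  "has_gateaux_gradient f l x \<longleftrightarrow> \<bar>f x\<bar> \<noteq> \<infinity> \<and>
     (\<forall>h. ((\<lambda>t::real. (f (x + t *\<^sub>R h) - f x) / ereal t) \<longlongrightarrow> ereal (blinfun_apply l h)) (at 0))"

definition gateaux_differentiable_on ::
  "('a::real_normed_vector \<Rightarrow> ereal) \<Rightarrow> 'a set \<Rightarrow> bool" where
  "gateaux_differentiable_on f S \<longleftrightarrow> (\<forall>x\<in>S. \<exists>l. has_gateaux_gradient f l x)"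

definition gradient :: "('a::real_normed_vector \<Rightarrow> ereal) \<Rightarrow> 'a \<Rightarrow> ('a \<Rightarrow>\<^sub>L real)" where
  "gradient f x = (THE l. has_gateaux_gradient f l x)"

text \<open>Meaningful for convex \<open>f\<close>, nowhere \<open>-\<infinity>\<close>, that are Gateaux differentiable on
  \<open>interior (edom f)\<close>; the values are then nonnegative.\<close>

definition bregman :: "('a::real_normed_vector \<Rightarrow> ereal) \<Rightarrow> 'a \<Rightarrow> 'a \<Rightarrow> ereal" where
  "bregman f x y =
     (if y \<in> interior (edom f)
      then f x - f y - ereal (blinfun_apply (gradient f y) (x - y)) else \<infinity>)"

definition bregman_set :: "('a::real_normed_vector \<Rightarrow> ereal) \<Rightarrow> 'a set \<Rightarrow> 'a \<Rightarrow> ereal" where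
  "bregman_set f C y = (INF x\<in>C. bregman f x y)"

definition coercive :: "('a::real_normed_vector \<Rightarrow> ereal) \<Rightarrow> bool" where
  "coercive h \<longleftrightarrow> (h \<longlongrightarrow> \<infinity>) at_infinity"

definition scaled :: "real \<Rightarrow> ('a \<Rightarrow> ereal) \<Rightarrow> 'a \<Rightarrow> ereal" where
  "scaled \<alpha> f = (\<lambda>x. ereal \<alpha> * f x)"

definition hat :: "('a::real_normed_vector \<Rightarrow> ereal) \<Rightarrow> 'a \<Rightarrow> ereal" where
  "hat f = (\<lambda>x. if x \<in> interior (edom f) then f x else \<infinity>)"

definition bregman_class :: "('a::real_normed_vector \<Rightarrow> ereal) \<Rightarrow> ('a \<Rightarrow> ereal) set" where
  "bregman_class f =
     {g \<in> Gamma0. edom g = interior (edom f) \<and> gateaux_differentiable_on g (edom g)}"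

text \<open>\<open>dominates f g\<^sub>1 g\<^sub>2\<close> is the relation \<open>g\<^sub>1 \<succcurlyeq> g\<^sub>2\<close>, which depends on the
  reference function \<open>f\<close>.\<close>

definition dominates ::
  "('a::real_normed_vector \<Rightarrow> ereal) \<Rightarrow> ('a \<Rightarrow> ereal) \<Rightarrow> ('a \<Rightarrow> ereal) \<Rightarrow> bool" where
  "dominates f g\<^sub>1 g\<^sub>2 \<longleftrightarrow>
     (\<forall>x\<in>edom f. \<forall>y\<in>interior (edom f). bregman g\<^sub>1 x y \<ge> bregman g\<^sub>2 x y)"

definition P_class :: "real \<Rightarrow> ('a::real_normed_vector \<Rightarrow> ereal) \<Rightarrow> ('a \<Rightarrow> ereal) set" where
  "P_class \<alpha> f = {g \<in> bregman_class f. dominates f g (scaled \<alpha> f)}"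

definition stationarily_quasi_bregman_monotone ::
  "('a::real_normed_vector \<Rightarrow> ereal) \<Rightarrow> 'a set \<Rightarrow> (nat \<Rightarrow> 'a \<Rightarrow> ereal) \<Rightarrow> (nat \<Rightarrow> 'a) \<Rightarrow> bool" where
  "stationarily_quasi_bregman_monotone f C fs x \<longleftrightarrow>
     (\<exists>\<epsilon> \<eta> :: nat \<Rightarrow> real.
        (\<forall>n. 0 \<le> \<epsilon> n) \<and> summable \<epsilon> \<and> (\<forall>n. 0 \<le> \<eta> n) \<and> summable \<eta> \<and>
        (\<forall>z\<in>C \<inter> edom f. \<forall>n.
           bregman (fs (Suc n)) z (x (Suc n))
             \<le> ereal (1 + \<eta> n) * bregman (fs n) z (x n) + ereal (\<epsilon> n)))"

end

theory Submission
  imports Defs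
begin

text \<open>Domination from both sides makes \<open>f\<close> Gateaux differentiable on \<open>interior (edom f)\<close>, and together
  with quasi-monotonicity it gives \<open>D z (x m) \<le> K * (D z (x n) + e n)\<close> for \<open>n \<le> m\<close>, with \<open>K\<close> and
  \<open>e \<longlonglongrightarrow> 0\<close> independent of \<open>z \<in> C \<inter> interior (edom f)\<close>.
  If the distances to \<open>C\<close> have limit inferior zero, a point \<open>c \<in> C\<close> close to one late \<open>x n\<close> therefore
  stays close to all later \<open>x m\<close>, and the separation hypothesis turns this into norm closeness, so
  \<open>x\<close> is Cauchy with limit in \<open>C\<close>.
  Conversely, if \<open>x \<longlonglongrightarrow> z\<close>, the distances from a fixed interior point are bounded, which forces the
  gradients at \<open>x n\<close> to be bounded; lower semicontinuity then yields \<open>z \<in> edom f\<close> and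
  \<open>D z (x n) \<longlonglongrightarrow> 0\<close>. Here \<open>D\<close> is the Bregman distance of \<open>f\<close>.\<close>

section \<open>Convex sets, effective domains and the passage from extended to real values\<close>

text \<open>Since \<open>t \<noteq> 0\<close>, the affine map \<open>?h\<close> is open; convexity
  sends \<open>interior A\<close> into \<open>A\<close>, hence the open image lies in
  \<open>interior A\<close>.\<close>

lemma convex_combination_interior:
  fixes A :: "'a::real_normed_vector set"
  assumes "convex A" "x \<in> A" "y \<in> interior A" "0 < t" "t \<le> 1"
  shows "(1 - t) *\<^sub>R x + t *\<^sub>R y \<in> interior A"
proof -
  let ?h = "\<lambda>u. (1 - t) *\<^sub>R x + t *\<^sub>R u"
  have "open (?h ` interior A)"
    using assms by (intro open_affinity) auto
  moreover have "?h ` interior A \<subseteq> A"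
  proof safe
    fix u assume "u \<in> interior A"
    then show "?h u \<in> A"
      using assms interior_subset by (intro convexD) auto
  qed
  ultimately have "?h ` interior A \<subseteq> interior A"
    by (rule interior_maximal[rotated])
  then show ?thesis
    using assms by auto
qed

lemma eventually_line_in_interior:
  fixes y h :: "'a::real_normed_vector"
  assumes "y \<in> interior A"
  shows "\<forall>\<^sub>F t in at (0::real). y + t *\<^sub>R h \<in> interior A"
proof -
  have "((\<lambda>t::real. y + t *\<^sub>R h) \<longlongrightarrow> y + 0 *\<^sub>R h) (at 0)"
    by (intro tendsto_intros)
  then show ?thesis
    using assms by (intro topological_tendstoD) auto
qed

lemma edom_finite:
  assumes "x \<in> edom f" "\<And>x. f x \<noteq> -\<infinity>"
  shows "f x = ereal (real_of_ereal (f x))"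
  using assms(1) assms(2)[of x] by (cases "f x") (auto simp: edom_def)

lemma edom_scaled: "c > 0 \<Longrightarrow> edom (scaled c f) = edom f"
  by (auto simp: edom_def scaled_def ereal_mult_less_0_iff less_top ereal_mult_eq_PInfty)

lemma scaled_not_MInf: "f x \<noteq> -\<infinity> \<Longrightarrow> c > 0 \<Longrightarrow> scaled c f x \<noteq> -\<infinity>"
  by (cases "f x") (auto simp: scaled_def)

lemma hat_not_MInf: "f x \<noteq> -\<infinity> \<Longrightarrow> hat f x \<noteq> -\<infinity>"
  by (simp add: hat_def)

lemma edom_hat: "edom (hat f) = interior (edom f)"
  using interior_subset[of "edom f"] by (auto simp: edom_def hat_def)

lemma convex_on_real_of_ereal:
  assumes "convex_fun f" and inf: "\<And>x. f x \<noteq> -\<infinity>"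
  shows "convex_on (edom f) (\<lambda>x. real_of_ereal (f x))"
proof -
  have *: "(1 - t) *\<^sub>R x + t *\<^sub>R y \<in> edom f \<and> real_of_ereal (f ((1 - t) *\<^sub>R x + t *\<^sub>R y))
      \<le> (1 - t) * real_of_ereal (f x) + t * real_of_ereal (f y)"
    if "0 < t" "t < 1" "x \<in> edom f" "y \<in> edom f" for t x y
  proof -
    let ?z = "(1 - t) *\<^sub>R x + t *\<^sub>R y"
    have "f ?z \<le> ereal (1 - t) * f x + ereal t * f y"
      using assms(1) that unfolding convex_fun_def by blast
    also have "\<dots> = ereal ((1 - t) * real_of_ereal (f x) + t * real_of_ereal (f y))"
      using edom_finite[OF that(3) inf] edom_finite[OF that(4) inf]
      by (metis plus_ereal.simps(1) times_ereal.simps(1))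
    finally show ?thesis
      using inf[of ?z] by (cases "f ?z") (auto simp: edom_def)
  qed
  have "convex (edom f)"
    unfolding convex_alt
  proof (intro ballI allI impI)
    fix x y u assume "x \<in> edom f" "y \<in> edom f" "0 \<le> u \<and> u \<le> (1::real)"
    then show "(1 - u) *\<^sub>R x + u *\<^sub>R y \<in> edom f"
      using *[of u x y] by (cases "u = 0 \<or> u = 1") auto
  qed
  then show ?thesis
    using * by (intro convex_onI) auto
qed

section \<open>Gateaux gradients and the gradient inequality\<close>

text \<open>Near \<open>t = 0\<close> the line through \<open>y\<close> stays in
  \<open>interior (edom f)\<close>, where \<open>f\<close> is finite, so the extended difference
  quotients are real and the limit rules for reals apply.\<close>

lemma has_gateaux_gradient_iff:
  assumes inf: "\<And>x. f x \<noteq> -\<infinity>" and y: "y \<in> interior (edom f)"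
  shows "has_gateaux_gradient f l y \<longleftrightarrow>
    (\<forall>h. ((\<lambda>t. (real_of_ereal (f (y + t *\<^sub>R h)) - real_of_ereal (f y)) / t) \<longlongrightarrow> l h) (at 0))"
proof -
  have fy: "f y = ereal (real_of_ereal (f y))"
    using y interior_subset by (intro edom_finite inf) auto
  have "\<forall>\<^sub>F t in at 0. (f (y + t *\<^sub>R h) - f y) / ereal t =
      ereal ((real_of_ereal (f (y + t *\<^sub>R h)) - real_of_ereal (f y)) / t)" for h
    using eventually_line_in_interior[OF y, of h] eventually_neq_at_within[of 0 0 UNIV]
  proof eventually_elim
    case (elim t)
    then have "f (y + t *\<^sub>R h) = ereal (real_of_ereal (f (y + t *\<^sub>R h)))"
      using interior_subset by (intro edom_finite inf) auto
    then show ?case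
      using fy elim by (metis ereal_minus(1) ereal_divide)
  qed
  note cong = tendsto_cong[OF this]
  have "\<bar>f y\<bar> \<noteq> \<infinity>"
    using fy by (metis PInfty_neq_ereal(1) abs_ereal.simps(1))
  then show ?thesis
    unfolding has_gateaux_gradient_def cong by simp
qed

lemma has_gateaux_gradient_unique:
  assumes "has_gateaux_gradient f l y" "has_gateaux_gradient f k y"
  shows "l = k"
proof (rule blinfun_eqI)
  fix h
  have "ereal (l h) = ereal (k h)"
    using assms unfolding has_gateaux_gradient_def
    by (intro tendsto_unique[where F = "at (0::real)"
          and f = "\<lambda>t. (f (y + t *\<^sub>R h) - f y) / ereal t"]) auto
  then show "l h = k h" by simp
qed

lemma gradient_eq: "has_gateaux_gradient f l y \<Longrightarrow> gradient f y = l"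
  unfolding gradient_def by (rule the_equality) (auto intro: has_gateaux_gradient_unique)

lemma has_gateaux_gradient_scaled:
  assumes "has_gateaux_gradient f l y" "\<And>x. f x \<noteq> -\<infinity>" "y \<in> interior (edom f)" "c > 0"
  shows "has_gateaux_gradient (scaled c f) (c *\<^sub>R l) y"
proof -
  have "((\<lambda>t. (real_of_ereal (scaled c f (y + t *\<^sub>R h)) - real_of_ereal (scaled c f y)) / t)
      \<longlongrightarrow> (c *\<^sub>R l) h) (at 0)" for h
  proof -
    have "((\<lambda>t. (real_of_ereal (f (y + t *\<^sub>R h)) - real_of_ereal (f y)) / t) \<longlongrightarrow> l h) (at 0)"
      using assms by (simp add: has_gateaux_gradient_iff)
    from tendsto_mult_left[OF this, of c] show ?thesis
      by (simp add: scaled_def blinfun.scaleR_left right_diff_distrib)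
  qed
  then show ?thesis
    using assms by (simp add: has_gateaux_gradient_iff edom_scaled scaled_not_MInf)
qed

text \<open>A Gateaux derivative at \<open>y\<close> depends only on values along lines near
  \<open>y\<close>, where \<open>f\<close> and \<open>hat f\<close> agree.\<close>

lemma has_gateaux_gradient_hat:
  assumes "has_gateaux_gradient f l y" "y \<in> interior (edom f)"
  shows "has_gateaux_gradient (hat f) l y"
proof -
  have "\<forall>\<^sub>F t in at 0. (f (y + t *\<^sub>R h) - f y) / ereal t =
      (hat f (y + t *\<^sub>R h) - hat f y) / ereal t" for h
    using eventually_line_in_interior[OF assms(2), of h]
    by eventually_elim (use assms(2) in \<open>simp add: hat_def\<close>)
  from tendsto_cong[OF this] show ?thesis
    using assms by (simp add: has_gateaux_gradient_def hat_def)
qed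

text \<open>For \<open>0 < t < 1\<close> convexity bounds the difference quotient towards
  \<open>x\<close> by \<open>?F x - ?F y\<close>; let \<open>t\<close> decrease to 0.\<close>

lemma convex_gradient_le:
  assumes "convex_fun f" and inf: "\<And>x. f x \<noteq> -\<infinity>" and y: "y \<in> interior (edom f)"
    and l: "has_gateaux_gradient f l y" and x: "x \<in> edom f"
  shows "real_of_ereal (f y) + l (x - y) \<le> real_of_ereal (f x)"
proof -
  let ?F = "\<lambda>x. real_of_ereal (f x)"
  have "((\<lambda>t. (?F (y + t *\<^sub>R (x - y)) - ?F y) / t) \<longlongrightarrow> l (x - y)) (at_right 0)"
    using l inf y by (simp add: has_gateaux_gradient_iff filterlim_at_split)
  moreover have "\<forall>\<^sub>F t in at_right 0. (?F (y + t *\<^sub>R (x - y)) - ?F y) / t \<le> ?F x - ?F y"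
    using eventually_at_right_less[of 0] eventually_at_right_real[OF zero_less_one]
  proof eventually_elim
    case (elim t)
    have "?F ((1 - t) *\<^sub>R y + t *\<^sub>R x) \<le> (1 - t) * ?F y + t * ?F x"
      using convex_on_real_of_ereal[OF assms(1) inf] elim x y interior_subset
      by (intro convex_onD) auto
    also have "(1 - t) *\<^sub>R y + t *\<^sub>R x = y + t *\<^sub>R (x - y)"
      by (simp add: algebra_simps)
    finally show ?case
      using elim by (simp add: field_simps)
  qed
  ultimately have "l (x - y) \<le> ?F x - ?F y"
    by (rule tendsto_upperbound) simp
  then show ?thesis by simp
qed

text \<open>The formula holds for whatever functional \<open>gradient f y\<close> denotes, so it can
  be applied to multiples of \<open>f\<close> and \<open>hat f\<close> while differentiability of
  \<open>f\<close> is still to be shown.\<close>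

lemma bregman_eq:
  assumes "\<And>x. f x \<noteq> -\<infinity>" "x \<in> edom f" "y \<in> interior (edom f)"
  shows "bregman f x y =
    ereal (real_of_ereal (f x) - real_of_ereal (f y) - gradient f y (x - y))"
proof -
  have "y \<in> edom f"
    using assms interior_subset by auto
  from edom_finite[OF assms(2,1)] edom_finite[OF this assms(1)] show ?thesis
    using assms(3) unfolding bregman_def by (metis ereal_minus(1))
qed

section \<open>Differentiability of \<open>f\<close> from two-sided domination\<close>

text \<open>Two majorizations suffice for differentiability: the upper bound of \<open>g\<close>'s Bregman distance
  by that of \<open>\<beta> f\<close> exhibits \<open>k\<^sub>2/\<beta>\<close> as a subgradient of \<open>f\<close>, and the lower one bounds the remaining
  difference quotient by that of \<open>g\<close>.\<close>

lemma has_gateaux_gradient_sandwich: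
  fixes f g :: "'a::real_normed_vector \<Rightarrow> ereal"
  defines "F \<equiv> \<lambda>x. real_of_ereal (f x)" and "G \<equiv> \<lambda>x. real_of_ereal (g x)"
  assumes f: "\<And>x. f x \<noteq> -\<infinity>" and g: "\<And>x. g x \<noteq> -\<infinity>" "convex_fun g"
    and dom: "interior (edom f) \<subseteq> edom g" and y: "y \<in> interior (edom f)"
    and k: "has_gateaux_gradient g k y"
    and "\<alpha> > 0" "\<beta> > 0"
    and lower: "\<And>x. x \<in> interior (edom f) \<Longrightarrow>
      \<alpha> * (F x - F y) - blinfun_apply k1 (x - y) \<le> G x - G y - k (x - y)"
    and upper: "\<And>x. x \<in> interior (edom f) \<Longrightarrow>
      G x - G y - k (x - y) \<le> \<beta> * (F x - F y) - blinfun_apply k2 (x - y)"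
  shows "has_gateaux_gradient f (k2 /\<^sub>R \<beta>) y"
proof -
  have yg: "y \<in> interior (edom g)"
    using y dom interior_maximal[OF dom] by auto
  let ?l = "k2 /\<^sub>R \<beta>"
  \<comment> \<open>The error of the difference quotient of \<open>g\<close>; it vanishes in the
    limit because \<open>k\<close> is the gradient of \<open>g\<close>.\<close>
  define r where "r h t = (G (y + t *\<^sub>R h) - G y) / t - k h" for h t
  have r: "(r h \<longlongrightarrow> 0) (at 0)" for h
  proof -
    have "((\<lambda>t. (G (y + t *\<^sub>R h) - G y) / t) \<longlongrightarrow> k h) (at 0)"
      using k g yg unfolding G_def by (simp add: has_gateaux_gradient_iff)
    then show ?thesis
      unfolding r_def by (simp add: LIM_zero_iff)
  qed
  have sub: "t * ?l h \<le> F (y + t *\<^sub>R h) - F y" if "y + t *\<^sub>R h \<in> interior (edom f)" for t h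
  proof -
    have "0 \<le> G (y + t *\<^sub>R h) - G y - k (t *\<^sub>R h)"
      using convex_gradient_le[OF g(2,1) yg k, of "y + t *\<^sub>R h"] that dom
      by (auto simp: G_def)
    with upper[OF that] have "k2 (t *\<^sub>R h) \<le> \<beta> * (F (y + t *\<^sub>R h) - F y)"
      by simp
    then show ?thesis
      using \<open>\<beta> > 0\<close> by (simp add: blinfun.scaleR_left blinfun.scaleR_right field_simps)
  qed
  have up: "\<alpha> * (F (y + t *\<^sub>R h) - F y) \<le> t * k1 h + t * r h t"
    if "y + t *\<^sub>R h \<in> interior (edom f)" "t \<noteq> 0" for t h
  proof -
    have "t * r h t = G (y + t *\<^sub>R h) - G y - t * k h"
      using that(2) by (simp add: r_def field_simps)
    then show ?thesis
      using lower[OF that(1)] by (simp add: blinfun.scaleR_right)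
  qed
  \<comment> \<open>Nothing is known about \<open>k1\<close> yet. Dividing \<open>sub\<close> and
    \<open>up\<close> by \<open>t > 0\<close> and letting \<open>t\<close> tend to 0 compares it
    with \<open>\<alpha> * ?l\<close>; as both are linear, using \<open>- h\<close> as well turns
    the inequality into equality.\<close>
  have le: "\<alpha> * ?l h \<le> k1 h" for h
  proof -
    have "((\<lambda>t. k1 h + r h t) \<longlongrightarrow> k1 h + 0) (at_right 0)"
      by (intro tendsto_intros tendsto_mono[OF at_le r]) auto
    moreover have "\<forall>\<^sub>F t in at_right 0. \<alpha> * ?l h \<le> k1 h + r h t"
    proof -
      have "\<forall>\<^sub>F t in at_right 0. y + t *\<^sub>R h \<in> interior (edom f)"
        using eventually_line_in_interior[OF y] by (rule filter_leD[OF at_le[OF subset_UNIV]])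
      with eventually_at_right_less[of 0] show ?thesis
      proof eventually_elim
        case (elim t)
        have "t * (\<alpha> * ?l h) \<le> \<alpha> * (F (y + t *\<^sub>R h) - F y)"
          using mult_left_mono[OF sub[OF elim(2)], of \<alpha>] \<open>\<alpha> > 0\<close> by (simp add: mult_ac)
        also have "\<dots> \<le> t * (k1 h + r h t)"
          using up[OF elim(2)] elim(1) by (simp add: distrib_left)
        finally show ?case
          using elim(1) by simp
      qed
    qed
    ultimately show ?thesis
      using tendsto_lowerbound[of _ _ "at_right (0::real)"] by force
  qed
  have eq: "k1 h = \<alpha> * ?l h" for h
    using le[of h] le[of "- h"] by (simp add: blinfun.minus_right)
  have "((\<lambda>t. (F (y + t *\<^sub>R h) - F y) / t) \<longlongrightarrow> ?l h) (at 0)" for h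
  proof (rule LIM_zero_cancel, rule Lim_null_comparison)
    show "((\<lambda>t. \<bar>r h t\<bar> / \<alpha>) \<longlongrightarrow> 0) (at 0)"
      using r[of h] \<open>\<alpha> > 0\<close> by (auto intro!: tendsto_eq_intros)
    show "\<forall>\<^sub>F t in at 0. norm ((F (y + t *\<^sub>R h) - F y) / t - ?l h) \<le> \<bar>r h t\<bar> / \<alpha>"
      using eventually_line_in_interior[OF y, of h] eventually_neq_at_within[of 0 0 UNIV]
    proof eventually_elim
      case (elim t)
      \<comment> \<open>The excess of \<open>F\<close> over its subgradient line: nonnegative by
        \<open>sub\<close>, and at most \<open>t * r h t / \<alpha>\<close> by \<open>up\<close> and
        \<open>eq\<close>, for either sign of \<open>t\<close>.\<close>
      let ?d = "F (y + t *\<^sub>R h) - F y - t * ?l h"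
      have "\<alpha> * ?d \<le> t * r h t"
        using up[OF elim] eq[of h] by (simp add: right_diff_distrib mult.left_commute)
      then have "\<alpha> * \<bar>?d\<bar> \<le> \<bar>t\<bar> * \<bar>r h t\<bar>"
        using sub[OF elim(1)] by (simp add: abs_mult[symmetric])
      moreover have "norm ((F (y + t *\<^sub>R h) - F y) / t - ?l h) = \<bar>?d\<bar> / \<bar>t\<bar>"
        using elim by (simp add: abs_divide[symmetric] diff_divide_distrib)
      ultimately show ?case
        using elim \<open>\<alpha> > 0\<close> by (simp add: field_simps)
    qed
  qed
  then show ?thesis
    using f y by (simp add: has_gateaux_gradient_iff F_def)
qed


text \<open>A single \<open>g\<close> bounded on both sides suffices. The gradients of
  \<open>scaled \<alpha> f\<close> and \<open>scaled \<beta> (hat f)\<close> are at this stage only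
  values of a definite description, so they enter the sandwich lemma as arbitrary functionals
  \<open>k1\<close> and \<open>k2\<close>.\<close>

lemma gateaux_differentiable_of_P_class:
  assumes f: "f \<in> Gamma0" and "\<alpha> > 0" "\<beta> > 0" and g: "g \<in> P_class \<alpha> f"
    and upper: "dominates f (scaled \<beta> (hat f)) g"
  shows "gateaux_differentiable_on f (interior (edom f))"
  unfolding gateaux_differentiable_on_def
proof
  fix y assume y: "y \<in> interior (edom f)"
  have fM: "f x \<noteq> -\<infinity>" for x
    using f by (simp add: Gamma0_def)
  have gG: "g \<in> Gamma0" "edom g = interior (edom f)" "gateaux_differentiable_on g (edom g)"
    and lower: "dominates f g (scaled \<alpha> f)"
    using g by (auto simp: P_class_def bregman_class_def)
  have gM: "g x \<noteq> -\<infinity>" for x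
    using gG(1) by (simp add: Gamma0_def)
  obtain k where k: "has_gateaux_gradient g k y"
    using gG(2,3) y unfolding gateaux_differentiable_on_def by metis
  let ?F = "\<lambda>x. real_of_ereal (f x)" and ?G = "\<lambda>x. real_of_ereal (g x)"
  let ?k1 = "gradient (scaled \<alpha> f) y" and ?k2 = "gradient (scaled \<beta> (hat f)) y"
  have bg: "bregman g x y = ereal (?G x - ?G y - k (x - y))" if "x \<in> interior (edom f)" for x
    using bregman_eq[of g x y] gM gG(2) that y gradient_eq[OF k] by simp
  have "\<alpha> * (?F x - ?F y) - ?k1 (x - y) \<le> ?G x - ?G y - k (x - y)"
    if x: "x \<in> interior (edom f)" for x
  proof -
    have "x \<in> edom f"
      using x interior_subset by auto
    then have "bregman (scaled \<alpha> f) x y \<le> bregman g x y"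
      using lower y by (simp add: dominates_def)
    then show ?thesis
      using bregman_eq[of "scaled \<alpha> f" x y] \<open>x \<in> edom f\<close> y \<open>\<alpha> > 0\<close>
      by (simp add: bg[OF x] fM scaled_not_MInf edom_scaled)
        (simp add: scaled_def right_diff_distrib)
  qed
  moreover have "?G x - ?G y - k (x - y) \<le> \<beta> * (?F x - ?F y) - ?k2 (x - y)"
    if x: "x \<in> interior (edom f)" for x
  proof -
    have "x \<in> edom f"
      using x interior_subset by auto
    then have "bregman g x y \<le> bregman (scaled \<beta> (hat f)) x y"
      using upper y by (simp add: dominates_def)
    then show ?thesis
      using bregman_eq[of "scaled \<beta> (hat f)" x y] x y \<open>\<beta> > 0\<close>
      by (simp add: bg[OF x] fM scaled_not_MInf hat_not_MInf edom_scaled edom_hat)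
        (simp add: scaled_def hat_def right_diff_distrib)
  qed
  ultimately show "\<exists>l. has_gateaux_gradient f l y"
    using has_gateaux_gradient_sandwich[of f g y k \<alpha> \<beta> ?k1 ?k2] fM gM gG y k assms(2,3)
    by (auto simp: Gamma0_def)
qed

section \<open>The Bregman distance of a Gateaux differentiable convex function\<close>

locale gateaux_convex =
  fixes f :: "'a::real_normed_vector \<Rightarrow> ereal"
  assumes convex: "convex_fun f"
    and not_MInf: "\<And>x. f x \<noteq> -\<infinity>"
    and differentiable: "gateaux_differentiable_on f (interior (edom f))"
begin

abbreviation U :: "'a set" where "U \<equiv> interior (edom f)"

abbreviation F :: "'a \<Rightarrow> real" where "F x \<equiv> real_of_ereal (f x)"

text \<open>A real-valued counterpart of \<open>bregman f\<close>. It is meaningful for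
  \<open>x \<in> edom f\<close> and \<open>y \<in> U\<close>; elsewhere \<open>real_of_ereal\<close>
  replaces infinities by 0.\<close>

definition D :: "'a \<Rightarrow> 'a \<Rightarrow> real" where
  "D x y = F x - F y - gradient f y (x - y)"

lemma U_edom: "x \<in> U \<Longrightarrow> x \<in> edom f"
  using interior_subset by auto

lemma has_gradient: "y \<in> U \<Longrightarrow> has_gateaux_gradient f (gradient f y) y"
  using differentiable gradient_eq unfolding gateaux_differentiable_on_def by metis

lemma bregman_eq_D: "x \<in> edom f \<Longrightarrow> y \<in> U \<Longrightarrow> bregman f x y = ereal (D x y)"
  unfolding D_def by (intro bregman_eq not_MInf)

lemma bregman_PInf: "x \<notin> edom f \<Longrightarrow> y \<in> U \<Longrightarrow> bregman f x y = \<infinity>"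
  using edom_finite[OF U_edom not_MInf, of y] unfolding bregman_def edom_def
  by (cases "f y") auto

lemma bregman_scaled:
  assumes "x \<in> edom f" "y \<in> U" "c > 0"
  shows "bregman (scaled c f) x y = ereal (c * D x y)"
proof -
  have "gradient (scaled c f) y = c *\<^sub>R gradient f y"
    using assms has_gradient
    by (intro gradient_eq has_gateaux_gradient_scaled not_MInf) auto
  then show ?thesis
    using bregman_eq[of "scaled c f" x y] assms
    by (simp add: scaled_not_MInf not_MInf edom_scaled D_def)
      (simp add: scaled_def blinfun.scaleR_left right_diff_distrib)
qed

text \<open>Here \<open>x\<close> must be interior, since \<open>hat f\<close> is infinite on the
  rest of \<open>edom f\<close>. This is why the uniform estimate below is confined to
  \<open>C \<inter> U\<close>.\<close>

lemma bregman_scaled_hat: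
  assumes "x \<in> U" "y \<in> U" "c > 0"
  shows "bregman (scaled c (hat f)) x y = ereal (c * D x y)"
proof -
  have "gradient (scaled c (hat f)) y = c *\<^sub>R gradient f y"
    using assms has_gradient
    by (intro gradient_eq has_gateaux_gradient_scaled has_gateaux_gradient_hat)
      (auto simp: edom_hat hat_not_MInf not_MInf)
  then show ?thesis
    using bregman_eq[of "scaled c (hat f)" x y] assms
    by (simp add: scaled_not_MInf hat_not_MInf not_MInf edom_scaled edom_hat D_def)
      (simp add: scaled_def hat_def blinfun.scaleR_left right_diff_distrib)
qed

lemma D_nonneg: "x \<in> edom f \<Longrightarrow> y \<in> U \<Longrightarrow> 0 \<le> D x y"
  using convex_gradient_le[OF convex not_MInf _ has_gradient, of y x] by (simp add: D_def)

lemma bregman_nonneg: "y \<in> U \<Longrightarrow> 0 \<le> bregman f x y"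
  by (cases "x \<in> edom f") (simp_all add: bregman_eq_D D_nonneg bregman_PInf)

lemma D_self [simp]: "D x x = 0"
  by (simp add: D_def blinfun.zero_right)

lemma convex_on_F: "convex_on (edom f) F"
  by (intro convex_on_real_of_ereal convex not_MInf)

lemma convex_edom: "convex (edom f)"
  using convex_on_F by (simp add: convex_on_def)

text \<open>As a function of its first argument, \<open>D\<close> differs from \<open>F\<close> by
  an affine function.\<close>

lemma convex_on_D: "convex_on (edom f) (\<lambda>x. D x y)"
proof (rule convex_onI[OF _ convex_edom])
  fix t :: real and a b assume t: "0 < t" "t < 1" and ab: "a \<in> edom f" "b \<in> edom f"
  have "F ((1 - t) *\<^sub>R a + t *\<^sub>R b) \<le> (1 - t) * F a + t * F b"
    using convex_on_F t ab by (intro convex_onD) auto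
  then show "D ((1 - t) *\<^sub>R a + t *\<^sub>R b) y \<le> (1 - t) * D a y + t * D b y"
    by (simp add: D_def blinfun.diff_right blinfun.add_right blinfun.scaleR_right algebra_simps)
qed

text \<open>Makes the local boundedness of the subdifferential available for gradients.\<close>

lemma gradient_in_subdifferential:
  assumes "y \<in> U"
  shows "gradient f y \<in> subdifferential f y"
  unfolding subdifferential_def
proof safe
  fix x
  show "ereal (gradient f y (x - y)) + f y \<le> f x"
  proof (cases "x \<in> edom f")
    case True
    have "gradient f y (x - y) + F y \<le> F x"
      using D_nonneg[OF True assms] by (simp add: D_def)
    then show ?thesis
      using edom_finite[OF True not_MInf] edom_finite[OF U_edom[OF assms] not_MInf]
      by (metis ereal_less_eq(3) plus_ereal.simps(1))
  qed (simp add: edom_def)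
qed

section \<open>Separation, boundedness and limits of Bregman distances\<close>

text \<open>Convexity of \<open>D\<close> in its first argument allows moving a point that is too far from \<open>v n\<close> to
  distance \<open>\<epsilon>\<close> without increasing \<open>D\<close>, so boundedness of the first sequence comes for free.\<close>

lemma bregman_separation:
  assumes sep: "\<And>u v :: nat \<Rightarrow> 'a.
           \<lbrakk>bounded (range u); bounded (range v); range u \<subseteq> U; range v \<subseteq> U;
            (\<lambda>n. bregman f (u n) (v n)) \<longlonglongrightarrow> 0\<rbrakk>
           \<Longrightarrow> (\<lambda>n. u n - v n) \<longlonglongrightarrow> 0"
    and B: "bounded B" "B \<subseteq> U" and "\<epsilon> > 0"
  shows "\<exists>\<delta>>0. \<forall>u\<in>U. \<forall>v\<in>B. D u v < \<delta> \<longrightarrow> norm (u - v) < \<epsilon>"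
proof (rule ccontr)
  assume neg: "\<not> ?thesis"
  have "\<exists>u v. u \<in> U \<and> v \<in> B \<and> D u v < 1 / real (Suc n) \<and> \<epsilon> \<le> norm (u - v)" for n
  proof -
    have "0 < 1 / real (Suc n)" by simp
    with neg show ?thesis
      by (meson not_le)
  qed
  then obtain u v where uv: "\<And>n. u n \<in> U" "\<And>n. v n \<in> B"
      "\<And>n. D (u n) (v n) < 1 / real (Suc n)" "\<And>n. \<epsilon> \<le> norm (u n - v n)"
    by metis
  have vU: "v n \<in> U" for n
    using uv(2) B(2) by auto
  \<comment> \<open>Chosen so that \<open>w n\<close>, on the segment from \<open>v n\<close> to
    \<open>u n\<close>, has distance exactly \<open>\<epsilon>\<close> from \<open>v n\<close>;
    \<open>t n \<le> 1\<close> because \<open>u n\<close> is at least that far away.\<close>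
  define t where "t n = \<epsilon> / norm (u n - v n)" for n
  define w where "w n = (1 - t n) *\<^sub>R v n + t n *\<^sub>R u n" for n
  have t: "0 < t n" "t n \<le> 1" for n
    using uv(4)[of n] \<open>\<epsilon> > 0\<close> by (auto simp: t_def divide_simps)
  have wv: "w n - v n = t n *\<^sub>R (u n - v n)" for n
    by (simp add: w_def algebra_simps)
  have norm_wv: "norm (w n - v n) = \<epsilon>" for n
    using t(1)[of n] uv(4)[of n] \<open>\<epsilon> > 0\<close> by (auto simp: wv t_def)
  have wU: "w n \<in> U" for n
    unfolding w_def using t[of n] uv(1) vU U_edom convex_edom
    by (intro convex_combination_interior) auto
  have Dw: "D (w n) (v n) < 1 / real (Suc n)" for n
  proof -
    have "D (w n) (v n) \<le> (1 - t n) * D (v n) (v n) + t n * D (u n) (v n)"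
      unfolding w_def using t[of n] uv(1) vU U_edom
      by (intro convex_onD[OF convex_on_D]) auto
    also have "\<dots> \<le> D (u n) (v n)"
      using t[of n] D_nonneg[OF U_edom[OF uv(1)] vU] by (simp add: mult_left_le_one_le)
    finally show ?thesis
      using uv(3)[of n] by simp
  qed
  have bv: "bounded (range v)"
    using B(1) uv(2) by (auto intro: bounded_subset)
  then obtain b where b: "\<And>n. norm (v n) \<le> b"
    by (auto simp: bounded_iff)
  have "norm (w n) \<le> b + \<epsilon>" for n
    using norm_triangle_ineq[of "v n" "w n - v n"] norm_wv[of n] b[of n] by simp
  then have bw: "bounded (range w)"
    by (auto simp: bounded_iff)
  have "(\<lambda>n. D (w n) (v n)) \<longlonglongrightarrow> 0"
  proof (rule tendsto_sandwich[OF _ _ tendsto_const lim_inverse_n'[THEN LIMSEQ_Suc]])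
    show "\<forall>\<^sub>F n in sequentially. 0 \<le> D (w n) (v n)"
      using D_nonneg wU vU U_edom by (intro always_eventually) auto
    show "\<forall>\<^sub>F n in sequentially. D (w n) (v n) \<le> 1 / real (Suc n)"
      using Dw less_imp_le by (intro always_eventually) blast
  qed
  then have "(\<lambda>n. bregman f (w n) (v n)) \<longlonglongrightarrow> 0"
    using wU vU U_edom by (simp add: bregman_eq_D zero_ereal_def)
  then have "(\<lambda>n. w n - v n) \<longlonglongrightarrow> 0"
    using wU vU by (intro sep bw bv) auto
  then have "(\<lambda>n. norm (w n - v n)) \<longlonglongrightarrow> 0"
    by (rule tendsto_norm_zero)
  then show False
    using \<open>\<epsilon> > 0\<close> by (simp add: norm_wv LIMSEQ_const_iff)
qed

lemma bounded_of_coercive: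
  assumes "coercive (bregman f w)" "w \<in> U" "\<And>n. x n \<in> U" "\<And>n. D w (x n) \<le> M"
  shows "bounded (range x)"
proof -
  obtain b where "\<And>v. b \<le> norm v \<Longrightarrow> ereal M < bregman f w v"
    using assms(1) unfolding coercive_def tendsto_PInfty eventually_at_infinity by blast
  then have "norm (x n) \<le> b" for n
    using assms U_edom by (metis bregman_eq_D ereal_less(3) less_ereal.simps(1) linorder_not_le nle_le)
  then show ?thesis
    by (auto simp: bounded_iff)
qed

text \<open>Bounded Bregman distances to an interior point force bounded gradients, because \<open>f\<close> is
  bounded above near that point. Hence even a limit on the boundary lies in \<open>edom f\<close>.\<close>

lemma bregman_limit_tendsto_0:
  assumes lsc: "lsc f" and loc: "locally_bounded_on_dom (subdifferential f)"
    and x: "\<And>n. x n \<in> U" "x \<longlonglongrightarrow> z" and w: "w \<in> U" "\<And>n. D w (x n) \<le> M"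
  shows "(\<lambda>n. bregman f z (x n)) \<longlonglongrightarrow> 0"
proof -
  let ?g = "\<lambda>n. gradient f (x n)"
  have "w \<in> op_dom (subdifferential f)"
    using gradient_in_subdifferential[OF w(1)] by (auto simp: op_dom_def)
  then obtain O' where O': "open O'" "w \<in> O'" "bounded (\<Union>y\<in>O'. subdifferential f y)"
    using loc unfolding locally_bounded_on_dom_def by blast
  from O'(3) obtain b where b: "\<And>y l. y \<in> O' \<Longrightarrow> l \<in> subdifferential f y \<Longrightarrow> norm l \<le> b"
    by (auto simp: bounded_iff)
  have "open (O' \<inter> U)" "w \<in> O' \<inter> U"
    using O' w(1) by auto
  then obtain r where r: "r > 0" "cball w r \<subseteq> O' \<inter> U"
    unfolding open_contains_cball by blast
  \<comment> \<open>The subgradient inequality is taken at the moving point \<open>u\<close> and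
    tested at \<open>w\<close>, so only the bound \<open>b\<close> on gradients near
    \<open>w\<close> enters.\<close>
  have F_near: "F u \<le> F w + b * r" if "u \<in> cball w r" for u
  proof -
    have u: "u \<in> O'" "u \<in> U"
      using that r(2) by auto
    have "F u \<le> F w + gradient f u (u - w)"
      using D_nonneg[OF U_edom[OF w(1)] u(2)] by (simp add: D_def blinfun.diff_right)
    also have "gradient f u (u - w) \<le> norm (gradient f u) * norm (u - w)"
      using norm_blinfun[of "gradient f u" "u - w"] by simp
    also have "\<dots> \<le> b * r"
      using b[OF u(1) gradient_in_subdifferential[OF u(2)]] that r(1) norm_ge_zero
      by (intro mult_mono)
        (auto simp: dist_norm norm_minus_commute intro: order_trans[OF norm_ge_zero])
    finally show ?thesis by simp
  qed
  \<comment> \<open>Subtracting \<open>D w (x n) \<le> M\<close> from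
    \<open>0 \<le> D (w + h) (x n)\<close> leaves \<open>?g n h \<le> F (w + h) - F w + M\<close>,
    and \<open>F_near\<close> bounds the increment by \<open>b * r\<close>.\<close>
  define c where "c = b * r + M"
  have g_le: "?g n h \<le> c" if "norm h \<le> r" for n h
  proof -
    have wh: "w + h \<in> cball w r"
      using that by (simp add: dist_norm)
    then have "w + h \<in> edom f"
      using r(2) U_edom by auto
    from D_nonneg[OF this x(1), of n] F_near[OF wh] w(2)[of n] show ?thesis
      by (simp add: D_def c_def blinfun.diff_right blinfun.add_right)
  qed
  have g_norm: "norm (?g n) \<le> c / r" for n
  proof (rule norm_blinfun_bound)
    show "0 \<le> c / r"
      using g_le[of 0 n] r(1) by (simp add: blinfun.zero_right)
    fix h
    show "norm (?g n h) \<le> c / r * norm h"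
    proof (cases "h = 0")
      case False
      let ?s = "r / norm h"
      have "?s * ?g n h \<le> c" "- (?s * ?g n h) \<le> c"
        using g_le[of "?s *\<^sub>R h" n] g_le[of "- (?s *\<^sub>R h)" n] False r(1)
        by (simp_all add: blinfun.scaleR_right blinfun.minus_right)
      then have "?s * \<bar>?g n h\<bar> \<le> c"
        by (cases "?g n h \<ge> 0") auto
      then show ?thesis
        using r(1) False by (simp add: field_simps)
    qed (simp add: blinfun.zero_right)
  qed
  have g_bound: "\<bar>?g n h\<bar> \<le> c / r * norm h" for n h
    using norm_blinfun[of "?g n" h] mult_right_mono[OF g_norm, of "norm h" n] by simp
  have lsc_ev: "\<forall>\<^sub>F n in sequentially. y < f (x n)" if "y < f z" for y
  proof -
    have "y < Liminf (nhds z) f"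
      using lsc that unfolding lsc_def by (meson order.strict_trans2)
    from less_LiminfD[OF this] show ?thesis
      using x(2) by (rule eventually_compose_filterlim)
  qed
  have ev_w: "\<forall>\<^sub>F n in sequentially. norm (x n - w) < norm (z - w) + 1"
    using x(2) by (intro order_tendstoD(2)[of _ "norm (z - w)"] tendsto_intros) auto
  \<comment> \<open>If \<open>f z\<close> were infinite, lower semicontinuity would push
    \<open>f (x n)\<close> above every real, whereas \<open>0 \<le> D w (x n)\<close> and the
    gradient bound keep it below \<open>?A\<close>.\<close>
  have z: "z \<in> edom f"
  proof (rule ccontr)
    let ?A = "F w + c / r * (norm (z - w) + 1)"
    assume "z \<notin> edom f"
    then have "\<forall>\<^sub>F n in sequentially. ereal ?A < f (x n)"
      by (intro lsc_ev) (auto simp: edom_def)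
    then have "\<forall>\<^sub>F n in sequentially. False"
      using ev_w
    proof eventually_elim
      case (elim n)
      have "0 \<le> c / r"
        using g_norm[of n] norm_ge_zero order_trans by blast
      then have "?g n (x n - w) \<le> c / r * (norm (z - w) + 1)"
        using g_bound[of n "x n - w"] mult_left_mono[OF less_imp_le[OF elim(2)], of "c / r"]
        by linarith
      then have "F (x n) \<le> ?A"
        using D_nonneg[OF U_edom[OF w(1)] x(1), of n] by (simp add: D_def blinfun.diff_right)
      then show False
        using elim(1) edom_finite[OF U_edom[OF x(1)] not_MInf, of n]
        by (metis ereal_less_eq(3) linorder_not_le)
    qed
    then show False by simp
  qed
  have "(\<lambda>n. D z (x n)) \<longlonglongrightarrow> 0"
  proof (rule order_tendstoI)
    fix a :: real assume "a < 0"
    then show "\<forall>\<^sub>F n in sequentially. a < D z (x n)"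
      using D_nonneg[OF z x(1)] by (intro always_eventually) (auto intro: less_le_trans)
  next
    \<comment> \<open>In \<open>D z (x n)\<close>, lower semicontinuity makes
      \<open>F z - F (x n)\<close> less than \<open>a / 2\<close>, and bounded gradients do the same
      for the linear term.\<close>
    fix a :: real assume "0 < a"
    have "\<forall>\<^sub>F n in sequentially. ereal (F z - a / 2) < f (x n)"
    proof (rule lsc_ev)
      have "ereal (F z - a / 2) < ereal (F z)"
        using \<open>0 < a\<close> by simp
      then show "ereal (F z - a / 2) < f z"
        using edom_finite[OF z not_MInf] by metis
    qed
    moreover have "\<forall>\<^sub>F n in sequentially. c / r * norm (z - x n) < a / 2"
    proof (rule order_tendstoD(2))
      have "(\<lambda>n. c / r * norm (z - x n)) \<longlonglongrightarrow> c / r * norm (z - z)"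
        using x(2) by (intro tendsto_intros)
      then show "(\<lambda>n. c / r * norm (z - x n)) \<longlonglongrightarrow> 0" by simp
    qed (use \<open>0 < a\<close> in simp)
    ultimately show "\<forall>\<^sub>F n in sequentially. D z (x n) < a"
    proof eventually_elim
      case (elim n)
      have "F z - a / 2 < F (x n)"
        using elim(1) edom_finite[OF U_edom[OF x(1)] not_MInf, of n]
        by (metis less_ereal.simps(1))
      then show ?case
        using g_bound[of n "z - x n"] elim(2) unfolding D_def by linarith
    qed
  qed
  then show ?thesis
    using z x(1) by (simp add: bregman_eq_D zero_ereal_def)
qed

text \<open>A near-minimizer may lie on the boundary of \<open>edom f\<close>. Moving it slightly
  towards \<open>w\<close> makes it interior, and convexity of \<open>D\<close> in its first
  argument preserves the strict bound.\<close>

lemma bregman_set_less_interior: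
  assumes "convex C" "w \<in> C \<inter> U" "y \<in> U" "bregman_set f C y < ereal \<delta>"
  shows "\<exists>c\<in>C \<inter> U. D c y < \<delta>"
proof -
  obtain c where c: "c \<in> C" "bregman f c y < ereal \<delta>"
    using assms(4) unfolding bregman_set_def INF_less_iff by auto
  then have ce: "c \<in> edom f"
    using bregman_PInf[OF _ assms(3)] by force
  have w: "w \<in> C" "w \<in> U"
    using assms(2) by auto
  have "((\<lambda>t. (1 - t) * D c y + t * D w y) \<longlongrightarrow> (1 - 0) * D c y + 0 * D w y) (at_right 0)"
    by (intro tendsto_intros)
  moreover have "(1 - 0) * D c y + 0 * D w y < \<delta>"
    using c(2) ce assms(3) by (simp add: bregman_eq_D)
  ultimately have "\<forall>\<^sub>F t in at_right 0. (1 - t) * D c y + t * D w y < \<delta>"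
    by (rule order_tendstoD(2))
  with eventually_at_right_real[OF zero_less_one]
  have "\<forall>\<^sub>F t in at_right 0. t \<in> {0<..<1} \<and> (1 - t) * D c y + t * D w y < \<delta>"
    by (rule eventually_conj)
  then obtain t where t: "0 < t" "t < 1" "(1 - t) * D c y + t * D w y < \<delta>"
    using eventually_happens[of _ "at_right (0::real)"] by force
  let ?c = "(1 - t) *\<^sub>R c + t *\<^sub>R w"
  have "?c \<in> C"
    using assms(1) c(1) w(1) t by (intro convexD) auto
  moreover have "?c \<in> U"
    using ce w(2) t convex_edom by (intro convex_combination_interior) auto
  moreover have "D ?c y \<le> (1 - t) * D c y + t * D w y"
    using t ce w(2) U_edom by (intro convex_onD[OF convex_on_D]) auto
  ultimately show ?thesis
    using t(3) by force
qed

end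

section \<open>Quasi-monotone recursions and the uniform Bregman estimate\<close>

text \<open>A discrete Gronwall inequality, based on
  \<open>1 + \<eta> n \<le> exp (\<eta> n)\<close>.\<close>

lemma quasi_monotone_exp_bound:
  fixes a \<eta> \<epsilon> :: "nat \<Rightarrow> real"
  assumes "\<And>n. a (Suc n) \<le> (1 + \<eta> n) * a n + \<epsilon> n"
    and "\<And>n. 0 \<le> a n" "\<And>n. 0 \<le> \<eta> n" "\<And>n. 0 \<le> \<epsilon> n" and "n \<le> m"
  shows "a m \<le> exp (\<Sum>i=n..<m. \<eta> i) * (a n + (\<Sum>i=n..<m. \<epsilon> i))"
  using \<open>n \<le> m\<close>
proof (induction m rule: dec_induct)
  case (step m)
  let ?E = "exp (\<Sum>i=n..<m. \<eta> i)" and ?S = "a n + (\<Sum>i=n..<m. \<epsilon> i)"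
  have E: "1 \<le> ?E" "1 \<le> exp (\<eta> m)"
    using assms(3) by (auto intro: sum_nonneg)
  have "a (Suc m) \<le> exp (\<eta> m) * a m + \<epsilon> m"
    using assms(1)[of m] mult_right_mono[OF exp_ge_add_one_self[of "\<eta> m"] assms(2)[of m]] by simp
  \<comment> \<open>The term \<open>\<epsilon> m\<close> is multiplied by a factor at least 1 so
    that the whole exponential can be factored out.\<close>
  also have "\<dots> \<le> exp (\<eta> m) * (?E * ?S) + (exp (\<eta> m) * ?E) * \<epsilon> m"
    using step.IH E assms(4)[of m] mult_mono[OF E(2,1)]
    by (intro add_mono mult_left_mono) (auto intro!: mult_le_cancel_right1[THEN iffD2])
  also have "\<dots> = exp (\<Sum>i=n..<Suc m. \<eta> i) * (a n + (\<Sum>i=n..<Suc m. \<epsilon> i))"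
    using step.hyps by (simp add: exp_add algebra_simps)
  finally show ?case .
qed simp


text \<open>The Gronwall bound for the distances of \<open>fs n\<close> is carried over to
  \<open>D\<close> by domination on both sides. \<open>K\<close> and \<open>e\<close> do not depend
  on \<open>z\<close> because stationarity fixes \<open>\<epsilon>\<close> and \<open>\<eta>\<close>
  before \<open>z\<close>.\<close>

lemma (in gateaux_convex) quasi_monotone_bound:
  assumes "\<alpha> > 0" "\<beta> > 0" and P: "\<And>n. fs n \<in> P_class \<alpha> f"
    and upper: "\<And>n. dominates f (scaled \<beta> (hat f)) (fs n)"
    and x: "\<And>n. x n \<in> U"
    and mono: "stationarily_quasi_bregman_monotone f C fs x"
  shows "\<exists>K e. K > 0 \<and> e \<longlonglongrightarrow> 0 \<and>
    (\<forall>z\<in>C \<inter> U. \<forall>n m. n \<le> m \<longrightarrow> D z (x m) \<le> K * (D z (x n) + e n))"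
proof -
  obtain \<epsilon> \<eta> where \<epsilon>: "\<And>n. 0 \<le> \<epsilon> n" "summable \<epsilon>" and \<eta>: "\<And>n. 0 \<le> \<eta> n" "summable \<eta>"
    and step: "\<And>z n. z \<in> C \<inter> edom f \<Longrightarrow> bregman (fs (Suc n)) z (x (Suc n))
             \<le> ereal (1 + \<eta> n) * bregman (fs n) z (x n) + ereal (\<epsilon> n)"
    using mono unfolding stationarily_quasi_bregman_monotone_def by blast
  define E where "E = exp (suminf \<eta>)"
  \<comment> \<open>The tail of the series of \<open>\<epsilon>\<close> from index \<open>n\<close>,
    divided by \<open>\<beta>\<close> so that \<open>\<beta>\<close> factors out of the final
    bound.\<close>
  define e where "e n = (suminf \<epsilon> - sum \<epsilon> {..<n}) / \<beta>" for n
  have "e \<longlonglongrightarrow> (suminf \<epsilon> - suminf \<epsilon>) / \<beta>"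
    unfolding e_def using summable_LIMSEQ[OF \<epsilon>(2)] \<open>\<beta> > 0\<close> by (intro tendsto_intros) auto
  moreover have "D z (x m) \<le> E * \<beta> / \<alpha> * (D z (x n) + e n)"
    if z: "z \<in> C \<inter> U" and "n \<le> m" for z n m
  proof -
    define a where "a n = real_of_ereal (bregman (fs n) z (x n))" for n
    have zf: "z \<in> edom f" "z \<in> U"
      using z U_edom by auto
    have a: "bregman (fs n) z (x n) = ereal (a n)" for n
    proof -
      have "fs n y \<noteq> -\<infinity>" "edom (fs n) = U" for y
        using P[of n] by (auto simp: P_class_def bregman_class_def Gamma0_def)
      then show ?thesis
        using bregman_eq[of "fs n" z "x n"] zf x by (simp add: a_def)
    qed
    have a_ge: "\<alpha> * D z (x n) \<le> a n" for n
    proof -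
      have "dominates f (fs n) (scaled \<alpha> f)"
        using P[of n] by (simp add: P_class_def)
      then have "bregman (scaled \<alpha> f) z (x n) \<le> bregman (fs n) z (x n)"
        using zf x by (simp add: dominates_def)
      then show ?thesis
        using zf x \<open>\<alpha> > 0\<close> by (simp add: a bregman_scaled)
    qed
    have a_le: "a n \<le> \<beta> * D z (x n)" for n
    proof -
      have "bregman (fs n) z (x n) \<le> bregman (scaled \<beta> (hat f)) z (x n)"
        using upper[of n] zf x by (simp add: dominates_def)
      then show ?thesis
        using zf x \<open>\<beta> > 0\<close> by (simp add: a bregman_scaled_hat)
    qed
    have a_nonneg: "0 \<le> a n" for n
      using a_ge[of n] D_nonneg[OF zf(1) x, of n] \<open>\<alpha> > 0\<close>
      by (meson less_imp_le mult_nonneg_nonneg order_trans)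
    have "a (Suc n) \<le> (1 + \<eta> n) * a n + \<epsilon> n" for n
      using step[of z n] z zf by (simp add: a)
    then have "a m \<le> exp (\<Sum>i=n..<m. \<eta> i) * (a n + (\<Sum>i=n..<m. \<epsilon> i))"
      using a_nonneg \<epsilon>(1) \<eta>(1) \<open>n \<le> m\<close> by (intro quasi_monotone_exp_bound) auto
    also have "\<dots> \<le> E * (\<beta> * D z (x n) + \<beta> * e n)"
    proof (intro mult_mono add_mono a_le)
      show "exp (\<Sum>i=n..<m. \<eta> i) \<le> E"
        unfolding E_def using \<eta> by (auto intro!: sum_le_suminf)
      have "(\<Sum>i=n..<m. \<epsilon> i) = sum \<epsilon> {..<m} - sum \<epsilon> {..<n}"
        using sum.atLeastLessThan_concat[OF le0 \<open>n \<le> m\<close>, of \<epsilon>]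
        by (simp add: lessThan_atLeast0)
      also have "\<dots> \<le> suminf \<epsilon> - sum \<epsilon> {..<n}"
        using \<epsilon> by (auto intro!: sum_le_suminf)
      also have "\<dots> = \<beta> * e n"
        using \<open>\<beta> > 0\<close> by (simp add: e_def)
      finally show "(\<Sum>i=n..<m. \<epsilon> i) \<le> \<beta> * e n" .
    qed (use a_nonneg \<epsilon>(1) in \<open>auto simp: E_def intro!: add_nonneg_nonneg sum_nonneg\<close>)
    finally have "\<alpha> * D z (x m) \<le> E * (\<beta> * D z (x n) + \<beta> * e n)"
      using a_ge[of m] by simp
    then show ?thesis
      using \<open>\<alpha> > 0\<close> by (simp add: field_simps)
  qed
  moreover have "E * \<beta> / \<alpha> > 0"
    using assms(1,2) by (simp add: E_def)
  ultimately show ?thesis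
    by (intro exI[of _ "E * \<beta> / \<alpha>"] exI[of _ e]) auto
qed

section \<open>Strong convergence and the lower limit of the distances to \<open>C\<close>\<close>

theorem proposition2p12:
  fixes f :: "'a::banach \<Rightarrow> ereal"
    and fs :: "nat \<Rightarrow> 'a \<Rightarrow> ereal"
    and x :: "nat \<Rightarrow> 'a"
    and C :: "'a set"
    and \<alpha> :: real
  assumes "reflexive_space TYPE('a)"
    and "f \<in> Gamma0" and "Legendre f"
    and "\<alpha> > 0"
    and "\<And>n. fs n \<in> P_class \<alpha> f"
    and "\<And>n. x n \<in> interior (edom f)"
    and "closed C" and "convex C" and "C \<inter> interior (edom f) \<noteq> {}"
    and "stationarily_quasi_bregman_monotone f C fs x"
    and "\<And>u v :: nat \<Rightarrow> 'a.
           \<lbrakk>bounded (range u); bounded (range v);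
            range u \<subseteq> interior (edom f); range v \<subseteq> interior (edom f);
            (\<lambda>n. bregman f (u n) (v n)) \<longlonglongrightarrow> 0\<rbrakk>
           \<Longrightarrow> (\<lambda>n. u n - v n) \<longlonglongrightarrow> 0"
    and "\<And>z. z \<in> interior (edom f) \<Longrightarrow> coercive (bregman f z)"
    and "\<exists>\<beta>::real. \<beta> > 0 \<and> (\<forall>n. dominates f (scaled \<beta> (hat f)) (fs n))"
  shows "(\<exists>z \<in> C \<inter> closure (edom f). x \<longlonglongrightarrow> z)
           \<longleftrightarrow> liminf (\<lambda>n. bregman_set f C (x n)) = 0"
proof -
  obtain \<beta> where \<beta>: "\<beta> > 0" "\<And>n. dominates f (scaled \<beta> (hat f)) (fs n)"
    using assms(13) by blast
  interpret gateaux_convex f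
    using assms(2) gateaux_differentiable_of_P_class[OF assms(2,4) \<beta>(1) assms(5) \<beta>(2)]
    by unfold_locales (auto simp: Gamma0_def)
  obtain K e where K: "K > 0" and e: "e \<longlonglongrightarrow> 0"
    and D_le: "\<And>z n m. z \<in> C \<inter> U \<Longrightarrow> n \<le> m \<Longrightarrow> D z (x m) \<le> K * (D z (x n) + e n)"
    using quasi_monotone_bound[OF assms(4) \<beta>(1) assms(5) \<beta>(2) assms(6,10)] by blast
  obtain w where w: "w \<in> C \<inter> U"
    using assms(9) by blast
  \<comment> \<open>Starting at index 0 bounds all \<open>D w (x m)\<close> by one constant, which
    both directions use.\<close>
  note D_w = D_le[OF w le0]
  have nonneg: "0 \<le> bregman_set f C (x n)" for n
    unfolding bregman_set_def by (intro INF_greatest bregman_nonneg assms(6))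
  show ?thesis
  proof
    assume "\<exists>z \<in> C \<inter> closure (edom f). x \<longlonglongrightarrow> z"
    then obtain z where z: "z \<in> C" "x \<longlonglongrightarrow> z"
      by blast
    have "(\<lambda>n. bregman f z (x n)) \<longlonglongrightarrow> 0"
      using assms(2,3,6) z(2) w D_w
      by (intro bregman_limit_tendsto_0[where w = w]) (auto simp: Gamma0_def Legendre_def)
    then have "(\<lambda>n. bregman_set f C (x n)) \<longlonglongrightarrow> 0"
      by (rule tendsto_sandwich[OF _ _ tendsto_const, rotated 2])
        (use nonneg z(1) in \<open>auto simp: bregman_set_def intro!: always_eventually INF_lower\<close>)
    then show "liminf (\<lambda>n. bregman_set f C (x n)) = 0"
      by (intro lim_imp_Liminf) auto
  next
    assume lim: "liminf (\<lambda>n. bregman_set f C (x n)) = 0"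
    have "bounded (range x)"
      using assms(6,12) w D_w by (intro bounded_of_coercive[where w = w]) auto
    \<comment> \<open>One point of \<open>C\<close> close to a whole tail gives both the Cauchy
      property, by the triangle inequality, and the membership of the limit in
      \<open>closure C\<close>.\<close>
    have near: "\<exists>c\<in>C. \<exists>n. \<forall>m\<ge>n. norm (c - x m) < r" if "r > 0" for r
    proof -
      obtain \<delta> where \<delta>: "\<delta> > 0" "\<And>u v. u \<in> U \<Longrightarrow> v \<in> range x \<Longrightarrow> D u v < \<delta> \<Longrightarrow> norm (u - v) < r"
        using bregman_separation[OF assms(11) \<open>bounded (range x)\<close> _ \<open>r > 0\<close>] assms(6) by blast
      \<comment> \<open>Both summands \<open>D c (x n)\<close> and \<open>e n\<close> will be below
        \<open>?\<gamma>\<close>, and \<open>K * (?\<gamma> + ?\<gamma>) = \<delta>\<close>.\<close>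
      let ?\<gamma> = "\<delta> / (2 * K)"
      have \<gamma>: "?\<gamma> > 0"
        using \<delta>(1) K by simp
      \<comment> \<open>A zero lower limit gives small distances only infinitely often; since
        \<open>e n\<close> is small eventually, some \<open>n\<close> has both, and
        \<open>D_le\<close> covers all later indices.\<close>
      have "\<exists>\<^sub>F n in sequentially. bregman_set f C (x n) < ereal ?\<gamma>"
      proof (rule ccontr)
        assume "\<not> ?thesis"
        then have "ereal ?\<gamma> \<le> liminf (\<lambda>n. bregman_set f C (x n))"
          by (intro Liminf_bounded) (simp add: not_frequently not_less)
        then show False
          using lim \<gamma> by simp
      qed
      moreover have "\<forall>\<^sub>F n in sequentially. e n < ?\<gamma>"
        using e \<gamma> by (rule order_tendstoD)
      ultimately have "\<exists>\<^sub>F n in sequentially. e n < ?\<gamma> \<and> bregman_set f C (x n) < ereal ?\<gamma>"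
        by (rule frequently_eventually_conj)
      then obtain n where n: "bregman_set f C (x n) < ereal ?\<gamma>" "e n < ?\<gamma>"
        using frequently_ex by blast
      obtain c where c: "c \<in> C \<inter> U" "D c (x n) < ?\<gamma>"
        using bregman_set_less_interior[OF assms(8) w assms(6) n(1)] by blast
      have "norm (c - x m) < r" if "n \<le> m" for m
      proof (rule \<delta>(2))
        have "D c (x m) \<le> K * (D c (x n) + e n)"
          by (rule D_le[OF c(1) that])
        also have "\<dots> < K * (?\<gamma> + ?\<gamma>)"
          using c(2) n(2) K by (intro mult_strict_left_mono add_strict_mono)
        also have "\<dots> = \<delta>"
          using K by simp
        finally show "D c (x m) < \<delta>" .
      qed (use c in auto)
      then show ?thesis
        using c(1) by blast
    qed
    have "Cauchy x"
    proof (rule metric_CauchyI)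
      fix r :: real assume "0 < r"
      then obtain c n where "\<forall>m\<ge>n. norm (c - x m) < r / 2"
        using near[of "r / 2"] by auto
      then have "\<forall>m\<ge>n. \<forall>k\<ge>n. dist (x m) (x k) < r"
        by (metis dist_commute dist_norm dist_triangle_half_l)
      then show "\<exists>n. \<forall>m\<ge>n. \<forall>k\<ge>n. dist (x m) (x k) < r"
        by blast
    qed
    then obtain z where z: "x \<longlonglongrightarrow> z"
      using Cauchy_convergent convergent_def by blast
    have "z \<in> closure C"
      unfolding closure_approachable
    proof safe
      fix r :: real assume "0 < r"
      then obtain c n where c: "c \<in> C" "\<forall>m\<ge>n. norm (c - x m) < r / 2"
        using near[of "r / 2"] by auto
      have "(\<lambda>m. norm (c - x m)) \<longlonglongrightarrow> norm (c - z)"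
        using z by (intro tendsto_intros)
      then have "norm (c - z) \<le> r / 2"
        using c(2) by (intro LIMSEQ_le_const2) (auto intro: less_imp_le)
      then show "\<exists>y\<in>C. dist y z < r"
        using c(1) \<open>0 < r\<close> by (auto simp: dist_norm intro!: bexI[of _ c])
    qed
    moreover have "z \<in> closure (edom f)"
      using z assms(6) U_edom by (auto simp: closure_sequential)
    ultimately show "\<exists>z \<in> C \<inter> closure (edom f). x \<longlonglongrightarrow> z"
      using z assms(7) by auto
  qed
qed

end
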